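(* Let $U\in\mathcal{L}$ and let $\rho_U:\mathcal{L}(\ell_1)\to\mathcal{L}_\downarrow(\ell_1)$ be given by $\rho_U(F)=\rho(U\,\overline{F})$. Suppose that there is a polynomial $V\in\mathcal{L}$, invertible in $\mathcal{L}(\ell_1)$, such that $d_0\ne0$ is invertible in $\mathcal{L}_\downarrow(\ell_1)$, where $D(z)=U(z)V(z)=\sum_{j\in E}d_jz^j$ with $d_j\in\mathcal{L}_\downarrow$. Let $D_j(z)=d_j-d_0z^{-j}$ for $j\in E\setminus\{0\}$. Then: (i) $\rho(U(z)V(z)D_j(z))=0$ for all $j\in E\setminus\{0\}$; (ii) the elements $H_j=\overline{V(z)}\,\overline{D_j(z)}$, $j\in E\setminus\{0\}$, form a basis of $\operatorname{Ker}\rho_U$ over $\mathcal{L}_\downarrow(\ell_1)$; (iii) if $H\in\mathcal{L}$ is a polynomial such that $\rho_U(H)$ is invertible in $\mathcal{L}_\downarrow(\ell_1)$, then the polynomials $\{H_j: j\in E\setminus\{0\}\}$ together with $H$ form a basis of $\mathcal{L}(\ell_1)$ over $\mathcal{L}_\downarrow(\ell_1)$.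
   Context: Let $d\ge1$, $E=\{0,1\}^d$, $\mathbb{T}^d=\{z\in\mathbb{C}^d:|z_j|=1\}$, $z^k=z_1^{k_1}\cdots z_d^{k_d}$ for $k\in\mathbb{Z}^d$. $\mathcal{L}$ is the ring of Laurent polynomials $\sum_{k\in M}a_kz^k$ ($M\subset\mathbb{Z}^d$ finite, $a_k\in\mathbb{C}$), and $\mathcal{L}(\ell_1)$ is the commutative ring of Laurent series $\sum_{k\in\mathbb{Z}^d}a_kz^k$ with $a\in\ell_1(\mathbb{Z}^d)$, considered as functions on $\mathbb{T}^d$. Subrings: $\mathcal{L}_\downarrow=\{P(z^2):P\in\mathcal{L}\}$ and $\mathcal{L}_\downarrow(\ell_1)=\{F(z^2):F\in\mathcal{L}(\ell_1)\}$, where $z^2=(z_1^2,\dots,z_d^2)$. $\mathcal{L}(\ell_1)$ is a free $\mathcal{L}_\downarrow(\ell_1)$-module with basis $z^j$, $j\in E$. Conjugation: $\overline{\sum a_kz^k}=\sum\overline{a_k}z^{-k}$. The map $\rho:\mathcal{L}(\ell_1)\to\mathcal{L}_\downarrow(\ell_1)$ sends $A=\sum_{j\in E}a_jz^j$ (unique $a_j\in\mathcal{L}_\downarrow(\ell_1)$) to $a_0$; equivalently $\rho(A)(z)=2^{-d}\sum_{s\in E}A((-1)^sz)$ with $(-1)^sz=((-1)^{s_1}z_1,\dots,(-1)^{s_d}z_d)$. $\operatorname{Ker}\rho_U=\{F\in\mathcal{L}(\ell_1):\rho_U(F)=0\}$. *)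

theory Defs
  imports "HOL-Analysis.Analysis" "HOL-Library.Function_Algebras"
begin

section \<open>The torus and its monomials\<close>

text \<open>
  The dimension \<open>d\<close> is the cardinality of the finite index type \<open>'n\<close>, so \<open>d \<ge> 1\<close> and
  \<open>\<int>^d\<close> is \<open>int ^ 'n\<close>. Functions on the torus carry the pointwise ring structure of
  \<open>HOL-Library.Function_Algebras\<close>.
\<close>

typedef ('n::finite) torus = "{z :: complex ^ 'n. \<forall>i. cmod (z $ i) = 1}"
  by (rule exI[of _ "\<chi> i. 1"]) simp

type_synonym 'n torus_fun = "'n torus \<Rightarrow> complex"

definition coord :: "'n::finite torus \<Rightarrow> 'n \<Rightarrow> complex" where
  "coord z i = Rep_torus z $ i"

definition torus_sq :: "'n::finite torus \<Rightarrow> 'n torus" where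
  "torus_sq z = Abs_torus (\<chi> i. coord z i ^ 2)"

definition monom_at :: "int ^ 'n \<Rightarrow> 'n::finite torus_fun" where
  "monom_at k = (\<lambda>z. \<Prod>i\<in>UNIV. coord z i powi (k $ i))"

definition cube :: "(int ^ 'n) set" where
  "cube = {j. \<forall>i. j $ i \<in> {0, 1}}"


section \<open>Laurent polynomials and absolutely summable Laurent series\<close>

definition laurent_series :: "(int ^ 'n \<Rightarrow> complex) \<Rightarrow> 'n::finite torus_fun" where
  "laurent_series a = (\<lambda>z. \<Sum>\<^sub>\<infinity>k. a k * monom_at k z)"

definition Lpoly :: "'n::finite torus_fun set" where
  "Lpoly = {F. \<exists>M a. finite M \<and> F = (\<lambda>z. \<Sum>k\<in>M. a k * monom_at k z)}"

definition ell1 :: "(int ^ 'n \<Rightarrow> complex) \<Rightarrow> bool" where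
  "ell1 a \<longleftrightarrow> (\<lambda>k. cmod (a k)) summable_on UNIV"

definition Ll1 :: "'n::finite torus_fun set" where
  "Ll1 = {laurent_series a | a. ell1 a}"

definition Lpoly_down :: "'n::finite torus_fun set" where
  "Lpoly_down = {P \<circ> torus_sq | P. P \<in> Lpoly}"

definition Ll1_down :: "'n::finite torus_fun set" where
  "Ll1_down = {F \<circ> torus_sq | F. F \<in> Ll1}"

definition invertible_in :: "'a::comm_ring_1 set \<Rightarrow> 'a \<Rightarrow> bool" where
  "invertible_in R x \<longleftrightarrow> x \<in> R \<and> (\<exists>y\<in>R. x * y = 1)"

text \<open>
  The family \<open>h\<close> indexed by the finite set \<open>I\<close> is a basis of \<open>M\<close> as a module over the
  subring \<open>R\<close>: its \<open>R\<close>-span is exactly \<open>M\<close>, and it is \<open>R\<close>-linearly independent.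
\<close>

definition is_basis_over :: "'a::comm_ring_1 set \<Rightarrow> 'a set \<Rightarrow> 'i set \<Rightarrow> ('i \<Rightarrow> 'a) \<Rightarrow> bool" where
  "is_basis_over R M I h \<longleftrightarrow>
     finite I \<and>
     M = {\<Sum>i\<in>I. c i * h i | c. \<forall>i\<in>I. c i \<in> R} \<and>
     (\<forall>c. (\<forall>i\<in>I. c i \<in> R) \<and> (\<Sum>i\<in>I. c i * h i) = 0 \<longrightarrow> (\<forall>i\<in>I. c i = 0))"


section \<open>Conjugation and the maps \<open>\<rho>\<close> and \<open>\<rho>\<^sub>U\<close>\<close>

text \<open>Meaningful on \<open>Ll1\<close> only, as are \<open>lconj\<close>, \<open>components\<close> and \<open>rho\<close> below.\<close>

definition coeffs :: "'n::finite torus_fun \<Rightarrow> int ^ 'n \<Rightarrow> complex" where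
  "coeffs F = (SOME a. ell1 a \<and> F = laurent_series a)"

definition lconj :: "'n::finite torus_fun \<Rightarrow> 'n torus_fun" where
  "lconj F = laurent_series (\<lambda>k. cnj (coeffs F (- k)))"

text \<open>
  The unique \<open>a\<^sub>j \<in> Ll1_down\<close>, \<open>j \<in> cube\<close>, with \<open>A = (\<Sum>j\<in>cube. a\<^sub>j * z^j)\<close>;
  the value \<open>0\<close> off the cube only serves to make the whole function unique.
\<close>

definition components :: "'n::finite torus_fun \<Rightarrow> int ^ 'n \<Rightarrow> 'n torus_fun" where
  "components A = (THE a. (\<forall>j\<in>cube. a j \<in> Ll1_down) \<and> (\<forall>j. j \<notin> cube \<longrightarrow> a j = 0) \<and>
                          A = (\<Sum>j\<in>cube. a j * monom_at j))"

definition rho :: "'n::finite torus_fun \<Rightarrow> 'n torus_fun" where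
  "rho A = components A 0"

definition rhoU :: "'n::finite torus_fun \<Rightarrow> 'n torus_fun \<Rightarrow> 'n torus_fun" where
  "rhoU U F = rho (U * lconj F)"

definition Ker_rhoU :: "'n::finite torus_fun \<Rightarrow> 'n torus_fun set" where
  "Ker_rhoU U = {F \<in> Ll1. rhoU U F = 0}"


section \<open>The definitions agree with their pointwise descriptions\<close>

lemma norm_coord [simp]: "cmod (coord z i) = 1"
  using Rep_torus[of z] by (simp add: coord_def)

lemma coord_nonzero [simp]: "coord z i \<noteq> 0"
  using norm_coord[of z i] by fastforce

lemma coord_torus_sq [simp]: "coord (torus_sq z) i = coord z i ^ 2"
  unfolding torus_sq_def by (subst coord_def, subst Abs_torus_inverse) (auto simp: norm_power)

lemma monom_at_0 [simp]: "monom_at 0 = 1"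
  by (simp add: monom_at_def fun_eq_iff)

lemma monom_at_add: "monom_at (j + k) z = monom_at j z * monom_at k z"
  by (simp add: monom_at_def power_int_add prod.distrib)

lemma monom_at_minus: "monom_at (- k) z = cnj (monom_at k z)"
proof -
  have "inverse (coord z i) = cnj (coord z i)" for i
    using complex_norm_square[of "coord z i"] by (simp add: field_simps)
  then show ?thesis
    by (simp add: monom_at_def power_int_minus flip: power_int_inverse)
qed

lemma monom_at_torus_sq: "monom_at k (torus_sq z) = monom_at (k + k) z"
  by (simp add: monom_at_def power_int_power flip: mult_2)

lemma norm_monom_at [simp]: "cmod (monom_at k z) = 1"
  by (simp add: monom_at_def norm_power_int flip: prod_norm)

lemma finite_cube [simp]: "finite (cube :: (int ^ 'n::finite) set)"
proof -
  have "cube \<subseteq> vec_lambda ` (UNIV \<rightarrow>\<^sub>E {0, 1 :: int} :: ('n \<Rightarrow> int) set)"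
  proof
    fix j :: "int ^ 'n" assume "j \<in> cube"
    then show "j \<in> vec_lambda ` (UNIV \<rightarrow>\<^sub>E {0, 1})"
      by (intro image_eqI[of _ _ "vec_nth j"]) (auto simp: cube_def)
  qed
  then show ?thesis
    by (rule finite_subset) (intro finite_imageI finite_PiE, auto)
qed

lemma zero_in_cube [simp]: "0 \<in> cube"
  by (simp add: cube_def)

lemma sum_fun_apply: "(\<Sum>i\<in>I. f i) x = (\<Sum>i\<in>I. f i x)"
  for f :: "'i \<Rightarrow> 'a \<Rightarrow> 'b::comm_monoid_add"
  by (induction I rule: infinite_finite_induct) auto

lemma coeffs_Ll1:
  assumes "F \<in> Ll1"
  shows "ell1 (coeffs F)" "laurent_series (coeffs F) = F"
proof -
  have "\<exists>a. ell1 a \<and> F = laurent_series a"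
    using assms by (auto simp: Ll1_def)
  from someI_ex[OF this] show "ell1 (coeffs F)" "laurent_series (coeffs F) = F"
    unfolding coeffs_def by auto
qed

lemma lconj_apply:
  assumes "F \<in> Ll1"
  shows "lconj F z = cnj (F z)"
proof -
  have "lconj F z = (\<Sum>\<^sub>\<infinity>k. cnj (coeffs F (- k)) * monom_at k z)"
    by (simp add: lconj_def laurent_series_def)
  also have "\<dots> = (\<Sum>\<^sub>\<infinity>k. cnj (coeffs F k) * monom_at (- k) z)"
    by (rule infsum_reindex_bij_witness[of _ uminus uminus]) auto
  also have "\<dots> = cnj (laurent_series (coeffs F) z)"
    by (simp add: monom_at_minus laurent_series_def flip: infsum_cnj)
  finally show ?thesis
    using coeffs_Ll1[OF assms] by simp
qed

definition sign_flip :: "int ^ 'n::finite \<Rightarrow> 'n torus \<Rightarrow> 'n torus" where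
  "sign_flip s z = Abs_torus (\<chi> i. (- 1) powi (s $ i) * coord z i)"

lemma coord_flip [simp]: "coord (sign_flip s z) i = (- 1) powi (s $ i) * coord z i"
  unfolding sign_flip_def
  by (subst coord_def, subst Abs_torus_inverse) (auto simp: norm_mult norm_power_int)

lemma coord_inject: "coord z = coord w \<Longrightarrow> z = w"
  by (metis (full_types) Rep_torus_inject coord_def vec_eq_iff)

lemma torus_sq_flip [simp]: "torus_sq (sign_flip s z) = torus_sq z"
  by (rule coord_inject) (auto simp: fun_eq_iff power_mult_distrib power_int_minus_left)

lemma monom_at_flip:
  "monom_at j (sign_flip s z) = (\<Prod>i\<in>UNIV. ((- 1) powi (s $ i)) powi (j $ i)) * monom_at j z"
  by (simp add: monom_at_def power_int_mult_distrib prod.distrib)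

lemma sum_cube_prod:
  "(\<Sum>s\<in>cube. \<Prod>i\<in>UNIV. f i (s $ i)) = (\<Prod>i\<in>UNIV. f i 0 + f i 1)"
  for f :: "'n::finite \<Rightarrow> int \<Rightarrow> complex"
proof -
  have "(\<Prod>i\<in>UNIV. f i 0 + f i 1) = (\<Prod>i\<in>UNIV. \<Sum>e\<in>{0, 1}. f i e)"
    by simp
  also have "\<dots> = (\<Sum>g\<in>(UNIV \<rightarrow>\<^sub>E {0, 1}). \<Prod>i\<in>UNIV. f i (g i))"
    by (rule prod_sum_PiE) auto
  also have "\<dots> = (\<Sum>s\<in>cube. \<Prod>i\<in>UNIV. f i (s $ i))"
    by (rule sum.reindex_bij_witness[of _ vec_nth vec_lambda]) (auto simp: cube_def)
  finally show ?thesis ..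
qed

lemma card_cube: "card (cube :: (int ^ 'n) set) = 2 ^ CARD('n::finite)"
proof -
  have "of_nat (card (cube :: (int ^ 'n) set)) = (of_nat (2 ^ CARD('n)) :: complex)"
    using sum_cube_prod[of "\<lambda>_::'n. \<lambda>_. 1"] by simp
  then show ?thesis
    by (simp only: of_nat_eq_iff)
qed

lemma sum_flip_monom:
  fixes z :: "'n::finite torus"
  assumes "j \<in> cube" "m \<in> cube"
  shows "(\<Sum>s\<in>cube. monom_at (j - m) (sign_flip s z)) = (if j = m then 2 ^ CARD('n) else 0)"
proof (cases "j = m")
  case False
  then obtain i where "j $ i \<noteq> m $ i"
    by (auto simp: vec_eq_iff)
  moreover have "j $ i \<in> {0, 1}" "m $ i \<in> {0, 1}"
    using assms unfolding cube_def by blast+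
  ultimately have i: "1 + (- 1 :: complex) powi (j $ i - m $ i) = 0"
    by auto
  have "(\<Sum>s\<in>cube. monom_at (j - m) (sign_flip s z))
      = (\<Sum>s\<in>cube. \<Prod>i\<in>UNIV. ((- 1) powi (s $ i)) powi (j $ i - m $ i)) * monom_at (j - m) z"
    by (simp add: monom_at_flip sum_distrib_right)
  also have "(\<Sum>s\<in>cube. \<Prod>i\<in>UNIV. ((- 1) powi (s $ i)) powi (j $ i - m $ i))
      = (\<Prod>i\<in>UNIV. 1 + (- 1 :: complex) powi (j $ i - m $ i))"
    by (subst sum_cube_prod) simp
  also have "\<dots> = 0"
    using i by (intro prod_zero) auto
  finally show ?thesis
    using False by simp
qed (simp add: card_cube)

lemma Ll1_down_flip: "b \<in> Ll1_down \<Longrightarrow> b (sign_flip s z) = b z"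
  by (auto simp: Ll1_down_def)

lemma component_average:
  fixes z :: "'n::finite torus"
  assumes "\<And>j. j \<in> cube \<Longrightarrow> a j \<in> Ll1_down" "m \<in> cube"
  shows "(\<Sum>s\<in>cube. (\<Sum>j\<in>cube. a j * monom_at j) (sign_flip s z) * monom_at (- m) (sign_flip s z))
         = 2 ^ CARD('n) * a m z"
proof -
  have "(\<Sum>s\<in>cube. (\<Sum>j\<in>cube. a j * monom_at j) (sign_flip s z) * monom_at (- m) (sign_flip s z))
      = (\<Sum>s\<in>cube. \<Sum>j\<in>cube. a j z * monom_at (j - m) (sign_flip s z))"
    using assms
    by (simp add: sum_fun_apply sum_distrib_right Ll1_down_flip mult.assoc
             flip: monom_at_add)
  also have "\<dots> = (\<Sum>j\<in>cube. a j z * (\<Sum>s\<in>cube. monom_at (j - m) (sign_flip s z)))"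
    by (subst sum.swap) (simp add: sum_distrib_left)
  also have "\<dots> = (\<Sum>j\<in>cube. if j = m then 2 ^ CARD('n) * a m z else 0)"
    using assms(2) by (intro sum.cong) (auto simp: sum_flip_monom)
  finally show ?thesis
    using assms(2) by simp
qed

lemma components_unique:
  assumes "\<And>j. j \<in> cube \<Longrightarrow> a j \<in> Ll1_down" "\<And>j. j \<in> cube \<Longrightarrow> b j \<in> Ll1_down"
    and "(\<Sum>j\<in>cube. a j * monom_at j) = (\<Sum>j\<in>cube. b j * monom_at j)" "m \<in> cube"
  shows "a m = b m"
proof
  fix z
  show "a m z = b m z"
    using component_average[of a m z] component_average[of b m z] assms by simp
qed

lemma cube_parity_bij:
  "bij_betw (\<lambda>(j, k). k + k + j) (cube \<times> UNIV) (UNIV :: (int ^ 'n) set)"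
proof (rule bij_betwI[where g = "\<lambda>m. (\<chi> i. m $ i mod 2, \<chi> i. m $ i div 2)"])
  show "(\<lambda>m. (\<chi> i. m $ i mod 2, \<chi> i. m $ i div 2)) ((\<lambda>(j, k). k + k + j) x) = x"
    if mem: "x \<in> cube \<times> UNIV" for x :: "(int ^ 'n) \<times> (int ^ 'n)"
  proof -
    obtain j k where x: "x = (j, k)" "j \<in> cube"
      using mem by auto
    have "(k $ i + k $ i + j $ i) mod 2 = j $ i \<and> (k $ i + k $ i + j $ i) div 2 = k $ i" for i
    proof -
      have "j $ i = 0 \<or> j $ i = 1"
        using x(2) by (auto simp: cube_def)
      then show ?thesis by presburger
    qed
    then show ?thesis
      by (simp add: x vec_eq_iff)
  qed
  show "(\<lambda>m. (\<chi> i. m $ i mod 2, \<chi> i. m $ i div 2)) \<in> (UNIV :: (int ^ 'n) set) \<rightarrow> cube \<times> UNIV"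
    by (auto simp: cube_def)
  show "(\<lambda>(j, k). k + k + j) (\<chi> i. m $ i mod 2, \<chi> i. m $ i div 2) = m" for m :: "int ^ 'n"
    by (simp add: vec_eq_iff flip: mult_2)
qed simp

lemma abs_summable_laurent:
  assumes "ell1 a"
  shows "(\<lambda>k. a k * monom_at k z) summable_on UNIV"
  by (rule abs_summable_summable) (use assms in \<open>simp add: ell1_def norm_mult\<close>)

lemma components_exist:
  assumes "A \<in> Ll1"
  shows "\<exists>b. (\<forall>j\<in>cube. b j \<in> Ll1_down) \<and> A = (\<Sum>j\<in>cube. b j * monom_at j)"
proof -
  obtain a where a: "ell1 a" "A = laurent_series a"
    using assms by (auto simp: Ll1_def)
  define b where "b j = laurent_series (\<lambda>k. a (k + k + j)) \<circ> torus_sq" for j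
  have inj: "inj (\<lambda>k. k + k + j)" for j :: "int ^ 'n"
    by (rule injI) (simp add: vec_eq_iff)
  have summ: "ell1 (\<lambda>k. a (k + k + j))" for j
  proof -
    have "(\<lambda>k. norm (a k)) summable_on range (\<lambda>k. k + k + j)"
      by (rule summable_on_subset_banach[OF a(1)[unfolded ell1_def]]) simp
    then show ?thesis
      by (subst (asm) summable_on_reindex[OF inj]) (simp add: ell1_def o_def)
  qed
  have "A z = (\<Sum>j\<in>cube. b j * monom_at j) z" for z
  proof -
    let ?f = "\<lambda>m. a m * monom_at m z"
    have s: "(\<lambda>(j, k). ?f (k + k + j)) summable_on cube \<times> UNIV"
      using abs_summable_laurent[OF a(1), of z]
        summable_on_reindex_bij_betw[OF cube_parity_bij, of ?f]
      by (simp add: case_prod_unfold)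
    have "A z = infsum ?f UNIV"
      by (simp add: a laurent_series_def)
    also have "\<dots> = infsum (\<lambda>(j, k). ?f (k + k + j)) (cube \<times> UNIV)"
      using infsum_reindex_bij_betw[OF cube_parity_bij, of ?f] by (simp add: case_prod_unfold)
    also have "\<dots> = infsum (\<lambda>j. infsum (\<lambda>k. ?f (k + k + j)) UNIV) cube"
      using infsum_Sigma'_banach[OF s] by simp
    also have "\<dots> = (\<Sum>j\<in>cube. infsum (\<lambda>k. ?f (k + k + j)) UNIV)"
      by simp
    also have "\<dots> = (\<Sum>j\<in>cube. b j z * monom_at j z)"
      by (simp add: b_def laurent_series_def monom_at_torus_sq monom_at_add mult.assoc
               flip: infsum_cmult_left')
    finally show ?thesis
      by (simp add: sum_fun_apply)
  qed
  then have "A = (\<Sum>j\<in>cube. b j * monom_at j)"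
    by blast
  moreover have "b j \<in> Ll1_down" for j
    using summ[of j] by (auto simp: Ll1_down_def Ll1_def b_def)
  ultimately show ?thesis
    by (intro exI[of _ b]) simp
qed

lemma components_Ll1:
  assumes "A \<in> Ll1"
  shows "\<forall>j\<in>cube. components A j \<in> Ll1_down" "A = (\<Sum>j\<in>cube. components A j * monom_at j)"
proof -
  let ?P = "\<lambda>a. (\<forall>j\<in>cube. a j \<in> Ll1_down) \<and> (\<forall>j. j \<notin> cube \<longrightarrow> a j = 0) \<and>
                  A = (\<Sum>j\<in>cube. a j * monom_at j)"
  obtain b where b: "\<forall>j\<in>cube. b j \<in> Ll1_down" "A = (\<Sum>j\<in>cube. b j * monom_at j)"
    using components_exist[OF assms] by blast
  have "\<exists>!a. ?P a"
  proof
    show "?P (\<lambda>j. if j \<in> cube then b j else 0)"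
      using b by simp
    show "a = (\<lambda>j. if j \<in> cube then b j else 0)" if "?P a" for a
    proof
      fix j
      show "a j = (if j \<in> cube then b j else 0)"
      proof (cases "j \<in> cube")
        case True
        then show ?thesis
          using components_unique[of a b j] that b by simp
      next
        case False
        then show ?thesis
          using that by simp
      qed
    qed
  qed
  from theI'[OF this] show "\<forall>j\<in>cube. components A j \<in> Ll1_down"
    "A = (\<Sum>j\<in>cube. components A j * monom_at j)"
    unfolding components_def by blast+
qed

lemma rho_Ll1: "A \<in> Ll1 \<Longrightarrow> rho A \<in> Ll1_down"
  using components_Ll1[of A] by (simp add: rho_def)

lemma rho_apply:
  fixes z :: "'n::finite torus"
  assumes "A \<in> Ll1"
  shows "rho A z = (\<Sum>s\<in>cube. A (sign_flip s z)) / 2 ^ CARD('n)"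
  using component_average[of "components A" 0 z] components_Ll1[OF assms]
  by (simp add: rho_def)

end

theory Submission
  imports Defs
begin

text \<open>
  Since \<open>\<rho>(z\<^sup>j z\<^sup>-\<^sup>k)\<close> is \<open>1\<close> for \<open>j = k\<close> and \<open>0\<close> otherwise, the form \<open>(A, B) \<mapsto> \<rho>(A B)\<close> pairs the
  bases \<open>z\<^sup>j\<close> and \<open>z\<^sup>-\<^sup>j\<close>, so for \<open>G = \<Sum> g\<^sub>j z\<^sup>-\<^sup>j\<close> the equation \<open>\<rho>(D G) = 0\<close> reads \<open>\<Sum> d\<^sub>j g\<^sub>j = 0\<close>.
  As \<open>d\<^sub>0\<close> is a unit, its solutions are freely generated by the \<open>D\<^sub>j\<close>. Multiplication by the
  unit \<open>V\<close> and conjugation carry this solution module onto the kernel of \<open>\<rho>\<^sub>U\<close>. A polynomial \<open>H\<close> with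
  \<open>\<rho>\<^sub>U(H)\<close> a unit splits off a complement of that kernel.
\<close>

section \<open>Ring structure\<close>

text \<open>Exponents may repeat, so the terms are grouped by the value of \<open>g\<close>: the
  fibres \<open>S m\<close> partition \<open>I\<close>, and the coefficient of z^m is the sum
  \<open>c m\<close> over its fibre. This brings sums over any index set into \<open>Ll1\<close>
  without computing their coefficients by hand.\<close>

lemma Ll1_infsum:
  fixes f :: "'i \<Rightarrow> complex" and g :: "'i \<Rightarrow> int ^ 'n::finite"
  assumes f: "(\<lambda>i. norm (f i)) summable_on I"
  shows "(\<lambda>z. \<Sum>\<^sub>\<infinity>i\<in>I. f i * monom_at (g i) z) \<in> Ll1"
proof -
  define S where "S m = {i \<in> I. g i = m}" for m
  have bij: "bij_betw snd (Sigma UNIV S) I"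
    by (rule bij_betwI[where g = "\<lambda>i. (g i, i)"]) (auto simp: S_def)
  have summ: "(\<lambda>p. h (snd p)) summable_on Sigma UNIV S" if "h summable_on I"
    for h :: "'i \<Rightarrow> 'b::banach"
    using summable_on_reindex_bij_betw[OF bij, of h] that by simp
  define c where "c m = infsum f (S m)" for m
  have norm_S: "(\<lambda>i. norm (f i)) summable_on S m" for m
    by (rule summable_on_subset_banach[OF f]) (auto simp: S_def)
  have "(\<lambda>m. \<Sum>\<^sub>\<infinity>i\<in>S m. norm (f i)) summable_on UNIV"
    using summable_on_Sigma_banach[of "\<lambda>_ i. norm (f i)" UNIV S] summ[OF f]
    by (simp add: case_prod_unfold)
  \<comment> \<open>Triangle inequality on each fibre: the norm of \<open>c m\<close> is at most the
    fibre sum of norms.\<close>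
  then have "(\<lambda>m. norm (c m)) summable_on UNIV"
    by (rule summable_on_comparison_test) (simp_all add: c_def norm_infsum_bound[OF norm_S])
  then have "ell1 c"
    by (simp add: ell1_def)
  moreover have "(\<Sum>\<^sub>\<infinity>i\<in>I. f i * monom_at (g i) z) = laurent_series c z" for z
  proof -
    let ?h = "\<lambda>i. f i * monom_at (g i) z"
    have h: "?h summable_on I"
      by (rule abs_summable_summable) (use f in \<open>simp add: norm_mult\<close>)
    have "infsum ?h I = infsum (\<lambda>p. ?h (snd p)) (Sigma UNIV S)"
      using infsum_reindex_bij_betw[OF bij, of ?h] by simp
    also have "\<dots> = (\<Sum>\<^sub>\<infinity>m. infsum ?h (S m))"
      using infsum_Sigma_banach[OF summ[OF h]] by simp
    also have "\<dots> = (\<Sum>\<^sub>\<infinity>m. c m * monom_at m z)"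
    proof (rule infsum_cong)
      fix m
      have "infsum ?h (S m) = (\<Sum>\<^sub>\<infinity>i\<in>S m. f i * monom_at m z)"
        by (rule infsum_cong) (simp add: S_def)
      then show "infsum ?h (S m) = c m * monom_at m z"
        by (simp add: c_def infsum_cmult_left')
    qed
    finally show ?thesis
      by (simp add: laurent_series_def)
  qed
  ultimately show ?thesis
    by (auto simp: Ll1_def)
qed

section \<open>Closure properties of Laurent polynomials\<close>

lemma Lpoly_subset_Ll1: "Lpoly \<subseteq> Ll1"
proof
  fix F :: "'n::finite torus_fun" assume "F \<in> Lpoly"
  then obtain M a where "finite M" "F = (\<lambda>z. \<Sum>k\<in>M. a k * monom_at k z)"
    by (auto simp: Lpoly_def)
  then show "F \<in> Ll1"
    using Ll1_infsum[of a M "\<lambda>k. k"] by simp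
qed

text \<open>Finite counterpart of \<open>Ll1_infsum\<close>: coefficients with the same exponent are
  collected, so \<open>g\<close> may be non-injective.\<close>

lemma Lpoly_sum_monom:
  assumes "finite I"
  shows "(\<lambda>z. \<Sum>i\<in>I. f i * monom_at (g i) z) \<in> Lpoly"
proof -
  have "(\<Sum>i\<in>I. f i * monom_at (g i) z)
      = (\<Sum>k\<in>g ` I. (\<Sum>i\<in>{i \<in> I. g i = k}. f i) * monom_at k z)" for z
    by (simp add: sum.image_gen[OF assms, of "\<lambda>i. f i * monom_at (g i) z" g] sum_distrib_right)
  then show ?thesis
    unfolding Lpoly_def using assms
    by (intro CollectI exI[of _ "g ` I"] exI[of _ "\<lambda>k. \<Sum>i\<in>{i \<in> I. g i = k}. f i"]) simp
qed

lemma Lpoly_monom: "monom_at k \<in> Lpoly"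
  using Lpoly_sum_monom[of "{k}" "\<lambda>_. 1" "\<lambda>k. k"] by simp

lemma Lpoly_mult:
  assumes "F \<in> Lpoly" "G \<in> Lpoly"
  shows "F * G \<in> Lpoly"
proof -
  obtain M a where F: "finite M" "F = (\<lambda>z. \<Sum>k\<in>M. a k * monom_at k z)"
    using assms by (auto simp: Lpoly_def)
  obtain N b where G: "finite N" "G = (\<lambda>z. \<Sum>k\<in>N. b k * monom_at k z)"
    using assms by (auto simp: Lpoly_def)
  have "F * G = (\<lambda>z. \<Sum>p\<in>M \<times> N. (a (fst p) * b (snd p)) * monom_at (fst p + snd p) z)"
    by (simp add: F G fun_eq_iff sum_product sum.cartesian_product monom_at_add case_prod_unfold
             mult_ac)
  then show ?thesis
    using F G Lpoly_sum_monom[of "M \<times> N"] by simp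
qed

lemma Lpoly_diff:
  assumes "F \<in> Lpoly" "G \<in> Lpoly"
  shows "F - G \<in> Lpoly"
proof -
  obtain M a where F: "finite M" "F = (\<lambda>z. \<Sum>k\<in>M. a k * monom_at k z)"
    using assms by (auto simp: Lpoly_def)
  obtain N b where G: "finite N" "G = (\<lambda>z. \<Sum>k\<in>N. b k * monom_at k z)"
    using assms by (auto simp: Lpoly_def)
  \<comment> \<open>The disjoint union keeps both sets of terms apart;
    \<open>Lpoly_sum_monom\<close> merges common exponents.\<close>
  have "F - G = (\<lambda>z. \<Sum>p\<in>M <+> N. case_sum a (\<lambda>k. - b k) p * monom_at (case_sum id id p) z)"
    using F G by (simp add: fun_eq_iff sum.Plus sum_negf)
  then show ?thesis
    using F G Lpoly_sum_monom[of "M <+> N"] by simp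
qed

lemma Lpoly_lconj:
  assumes "F \<in> Lpoly"
  shows "lconj F \<in> Lpoly"
proof -
  obtain M a where F: "finite M" "F = (\<lambda>z. \<Sum>k\<in>M. a k * monom_at k z)"
    using assms by (auto simp: Lpoly_def)
  have "lconj F = (\<lambda>z. \<Sum>k\<in>M. cnj (a k) * monom_at (- k) z)"
    using lconj_apply[of F] assms Lpoly_subset_Ll1
    by (auto simp: fun_eq_iff F(2) monom_at_minus)
  then show ?thesis
    using F Lpoly_sum_monom[of M] by simp
qed

lemma Lpoly_down_subset_Lpoly: "Lpoly_down \<subseteq> Lpoly"
proof
  fix F :: "'n::finite torus_fun" assume "F \<in> Lpoly_down"
  then obtain M a where "finite M" "F = (\<lambda>z. \<Sum>k\<in>M. a k * monom_at k z) \<circ> torus_sq"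
    by (auto simp: Lpoly_down_def Lpoly_def)
  then show "F \<in> Lpoly"
    using Lpoly_sum_monom[of M a "\<lambda>k. k + k"] by (simp add: o_def monom_at_torus_sq)
qed

lemma Lpoly_down_subset_Ll1_down: "Lpoly_down \<subseteq> Ll1_down"
  using Lpoly_subset_Ll1 by (auto simp: Lpoly_down_def Ll1_down_def)

section \<open>The ring of absolutely summable series\<close>

lemma Ll1_monom: "monom_at k \<in> Ll1"
  using Lpoly_monom Lpoly_subset_Ll1 by blast

lemma Ll1_0: "0 \<in> Ll1"
  using Ll1_infsum[of "\<lambda>_. 0" "{}"] by (simp add: zero_fun_def)

lemma Ll1_mult:
  assumes "F \<in> Ll1" "G \<in> Ll1"
  shows "F * G \<in> Ll1"
proof -
  obtain a where F: "ell1 a" "F = laurent_series a"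
    using assms by (auto simp: Ll1_def)
  obtain b where G: "ell1 b" "G = laurent_series b"
    using assms by (auto simp: Ll1_def)
  \<comment> \<open>Absolute summability over pairs justifies Fubini below, and lets
    \<open>Ll1_infsum\<close> form the convolution by grouping pairs with equal exponent
    sum.\<close>
  have prod: "(\<lambda>p. norm (a (fst p) * b (snd p))) summable_on UNIV \<times> UNIV"
    by (rule iffD2[OF Infinite_Sum.abs_summable_on_Sigma_iff])
       (use F(1) G(1) in \<open>auto simp: ell1_def norm_mult infsum_cmult_right' abs_mult
          intro!: summable_on_cmult_right summable_on_cmult_left\<close>)
  have "F z * G z = (\<Sum>\<^sub>\<infinity>p\<in>UNIV \<times> UNIV. (a (fst p) * b (snd p)) * monom_at (fst p + snd p) z)"
    for z
  proof -
    let ?h = "\<lambda>p. (a (fst p) * b (snd p)) * monom_at (fst p + snd p) z"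
    have h: "?h summable_on UNIV \<times> UNIV"
      by (rule abs_summable_summable) (use prod in \<open>simp add: norm_mult\<close>)
    have "F z * G z = (\<Sum>\<^sub>\<infinity>k. a k * monom_at k z * (\<Sum>\<^sub>\<infinity>l. b l * monom_at l z))"
      unfolding F(2) G(2) laurent_series_def infsum_cmult_left' ..
    also have "\<dots> = (\<Sum>\<^sub>\<infinity>k. \<Sum>\<^sub>\<infinity>l. ?h (k, l))"
      by (simp add: monom_at_add mult_ac flip: infsum_cmult_right')
    also have "\<dots> = infsum ?h (UNIV \<times> UNIV)"
      by (rule infsum_Sigma_banach[OF h])
    finally show ?thesis .
  qed
  then have "F * G = (\<lambda>z. \<Sum>\<^sub>\<infinity>p\<in>UNIV \<times> UNIV. (a (fst p) * b (snd p)) * monom_at (fst p + snd p) z)"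
    by (simp add: fun_eq_iff)
  then show ?thesis
    using Ll1_infsum[OF prod] by simp
qed

lemma Ll1_add:
  assumes "F \<in> Ll1" "G \<in> Ll1"
  shows "F + G \<in> Ll1"
proof -
  obtain a where F: "ell1 a" "F = laurent_series a"
    using assms by (auto simp: Ll1_def)
  obtain b where G: "ell1 b" "G = laurent_series b"
    using assms by (auto simp: Ll1_def)
  have "(\<lambda>k. norm (a k + b k)) summable_on UNIV"
    by (rule summable_on_comparison_test[OF summable_on_add[OF F(1)[unfolded ell1_def] G(1)[unfolded ell1_def]]])
       (auto intro: norm_triangle_ineq)
  then have "ell1 (\<lambda>k. a k + b k)"
    by (simp add: ell1_def)
  moreover have "F + G = laurent_series (\<lambda>k. a k + b k)"
    using F G by (simp add: fun_eq_iff laurent_series_def distrib_right infsum_add abs_summable_laurent)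
  ultimately show ?thesis
    by (auto simp: Ll1_def)
qed

lemma Ll1_uminus: "F \<in> Ll1 \<Longrightarrow> - F \<in> Ll1"
proof -
  \<comment> \<open>The constant -1 is a one-term series with exponent 0; negation is multiplication
    by it.\<close>
  have "(- 1 :: 'n::finite torus_fun) \<in> Ll1"
    using Ll1_infsum[of "\<lambda>_. - 1" "{()}" "\<lambda>_. 0"] by (simp add: one_fun_def fun_Compl_def)
  then show "F \<in> Ll1 \<Longrightarrow> - F \<in> Ll1"
    using Ll1_mult[of "- 1" F] by simp
qed

lemma Ll1_diff: "F \<in> Ll1 \<Longrightarrow> G \<in> Ll1 \<Longrightarrow> F - G \<in> Ll1"
  using Ll1_add[of F "- G"] Ll1_uminus[of G] by simp

lemma Ll1_sum: "(\<And>i. i \<in> I \<Longrightarrow> F i \<in> Ll1) \<Longrightarrow> (\<Sum>i\<in>I. F i) \<in> Ll1"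
  by (induction I rule: infinite_finite_induct) (auto simp: Ll1_0 Ll1_add)

lemma Ll1_lconj:
  assumes "F \<in> Ll1"
  shows "lconj F \<in> Ll1"
proof -
  have "(\<lambda>k. norm (cnj (coeffs F k))) summable_on UNIV"
    using coeffs_Ll1[OF assms] by (simp add: ell1_def)
  from Ll1_infsum[OF this, of uminus]
  have "(\<lambda>z. \<Sum>\<^sub>\<infinity>k. cnj (coeffs F k) * monom_at (- k) z) \<in> Ll1" .
  moreover have "lconj F z = (\<Sum>\<^sub>\<infinity>k. cnj (coeffs F k) * monom_at (- k) z)" for z
    unfolding lconj_def laurent_series_def
    by (rule infsum_reindex_bij_witness[of _ uminus uminus]) auto
  ultimately show ?thesis
    by presburger
qed

section \<open>The subring of series in z^2\<close>

lemma Ll1_down_subset_Ll1: "Ll1_down \<subseteq> Ll1"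
proof
  fix F :: "'n::finite torus_fun" assume "F \<in> Ll1_down"
  then obtain a where "ell1 a" "F = laurent_series a \<circ> torus_sq"
    by (auto simp: Ll1_down_def Ll1_def)
  then show "F \<in> Ll1"
    using Ll1_infsum[of a UNIV "\<lambda>k. k + k"]
    by (simp add: ell1_def o_def laurent_series_def monom_at_torus_sq)
qed

lemma Ll1_down_0: "0 \<in> Ll1_down"
  unfolding Ll1_down_def by (rule CollectI, rule exI[of _ 0]) (auto simp: Ll1_0)

lemma Ll1_down_add: "F \<in> Ll1_down \<Longrightarrow> G \<in> Ll1_down \<Longrightarrow> F + G \<in> Ll1_down"
proof -
  assume "F \<in> Ll1_down" "G \<in> Ll1_down"
  then obtain F' G' where "F' \<in> Ll1" "G' \<in> Ll1" "F = F' \<circ> torus_sq" "G = G' \<circ> torus_sq"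
    by (auto simp: Ll1_down_def)
  then show ?thesis
    unfolding Ll1_down_def
    by (intro CollectI exI[of _ "F' + G'"]) (auto simp: Ll1_add)
qed

lemma Ll1_down_mult: "F \<in> Ll1_down \<Longrightarrow> G \<in> Ll1_down \<Longrightarrow> F * G \<in> Ll1_down"
proof -
  assume "F \<in> Ll1_down" "G \<in> Ll1_down"
  then obtain F' G' where "F' \<in> Ll1" "G' \<in> Ll1" "F = F' \<circ> torus_sq" "G = G' \<circ> torus_sq"
    by (auto simp: Ll1_down_def)
  then show ?thesis
    unfolding Ll1_down_def
    by (intro CollectI exI[of _ "F' * G'"]) (auto simp: Ll1_mult)
qed

lemma Ll1_down_uminus: "F \<in> Ll1_down \<Longrightarrow> - F \<in> Ll1_down"
proof -
  assume "F \<in> Ll1_down"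
  then obtain F' where "F' \<in> Ll1" "F = F' \<circ> torus_sq"
    by (auto simp: Ll1_down_def)
  then show ?thesis
    unfolding Ll1_down_def
    by (intro CollectI exI[of _ "- F'"]) (auto simp: Ll1_uminus)
qed

lemma Ll1_down_lconj: "F \<in> Ll1_down \<Longrightarrow> lconj F \<in> Ll1_down"
proof -
  assume F: "F \<in> Ll1_down"
  then obtain F' where F': "F' \<in> Ll1" "F = F' \<circ> torus_sq"
    by (auto simp: Ll1_down_def)
  have "F \<in> Ll1"
    using F Ll1_down_subset_Ll1 by blast
  \<comment> \<open>On \<open>Ll1\<close> conjugation acts on values, so it commutes with
    substituting z^2.\<close>
  then have "lconj F = lconj F' \<circ> torus_sq"
    using F' by (intro ext) (simp add: lconj_apply)
  then show ?thesis
    unfolding Ll1_down_def using F' Ll1_lconj by blast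
qed

lemma Ll1_down_sum: "(\<And>i. i \<in> I \<Longrightarrow> F i \<in> Ll1_down) \<Longrightarrow> (\<Sum>i\<in>I. F i) \<in> Ll1_down"
  by (induction I rule: infinite_finite_induct) (auto simp: Ll1_down_0 Ll1_down_add)

section \<open>Conjugation and averaging\<close>

lemma lconj_lconj: "F \<in> Ll1 \<Longrightarrow> lconj (lconj F) = F"
  by (simp add: fun_eq_iff lconj_apply Ll1_lconj)

lemma lconj_mult: "F \<in> Ll1 \<Longrightarrow> G \<in> Ll1 \<Longrightarrow> lconj (F * G) = lconj F * lconj G"
  by (simp add: fun_eq_iff lconj_apply Ll1_mult)

lemma lconj_add: "F \<in> Ll1 \<Longrightarrow> G \<in> Ll1 \<Longrightarrow> lconj (F + G) = lconj F + lconj G"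
  by (simp add: fun_eq_iff lconj_apply Ll1_add)

lemma lconj_0: "lconj 0 = 0"
  by (simp add: fun_eq_iff lconj_apply Ll1_0)

lemma lconj_sum: "(\<And>i. i \<in> I \<Longrightarrow> F i \<in> Ll1) \<Longrightarrow> lconj (\<Sum>i\<in>I. F i) = (\<Sum>i\<in>I. lconj (F i))"
  by (simp add: fun_eq_iff lconj_apply Ll1_sum sum_fun_apply)

lemma lconj_monom: "lconj (monom_at k) = monom_at (- k)"
  by (simp add: fun_eq_iff lconj_apply Ll1_monom monom_at_minus)

section \<open>Linearity of \<open>rho\<close> and the dual bases z^j, z^-j\<close>

lemma rho_add: "A \<in> Ll1 \<Longrightarrow> B \<in> Ll1 \<Longrightarrow> rho (A + B) = rho A + rho B"
  by (simp add: fun_eq_iff rho_apply Ll1_add sum.distrib add_divide_distrib)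

lemma rho_0: "rho 0 = 0"
  by (simp add: fun_eq_iff rho_apply Ll1_0)

lemma rho_sum: "(\<And>i. i \<in> I \<Longrightarrow> A i \<in> Ll1) \<Longrightarrow> rho (\<Sum>i\<in>I. A i) = (\<Sum>i\<in>I. rho (A i))"
  by (induction I rule: infinite_finite_induct) (auto simp: rho_0 rho_add Ll1_sum)

text \<open>A series in z^2 is unchanged by sign flips, so it factors out of the average that
  computes \<open>rho\<close>.\<close>

lemma rho_mult_down:
  assumes "c \<in> Ll1_down" "A \<in> Ll1"
  shows "rho (c * A) = c * rho A"
proof
  fix z
  have "c \<in> Ll1"
    using assms Ll1_down_subset_Ll1 by blast
  then show "rho (c * A) z = (c * rho A) z"
    using assms by (simp add: rho_apply Ll1_mult Ll1_down_flip flip: sum_distrib_left)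
qed

lemma rho_monom_dual:
  assumes "\<And>j. j \<in> cube \<Longrightarrow> a j \<in> Ll1_down" "m \<in> cube"
  shows "rho ((\<Sum>j\<in>cube. a j * monom_at j) * monom_at (- m)) = a m"
proof
  fix z
  have "(\<Sum>j\<in>cube. a j * monom_at j) * monom_at (- m) \<in> Ll1"
    using assms Ll1_down_subset_Ll1 by (intro Ll1_mult Ll1_sum Ll1_monom) auto
  then show "rho ((\<Sum>j\<in>cube. a j * monom_at j) * monom_at (- m)) z = a m z"
    using component_average[of a m z] assms by (simp add: rho_apply)
qed

text \<open>By linearity over \<open>Ll1_down\<close> the pairing reduces to
  \<open>rho (A * monom_at (- j))\<close>, which extracts the component \<open>a j\<close>.\<close>

lemma rho_pairing:
  fixes a b :: "int ^ 'n::finite \<Rightarrow> 'n torus_fun"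
  assumes a: "\<And>j. j \<in> cube \<Longrightarrow> a j \<in> Ll1_down" and b: "\<And>j. j \<in> cube \<Longrightarrow> b j \<in> Ll1_down"
  shows "rho ((\<Sum>j\<in>cube. a j * monom_at j) * (\<Sum>j\<in>cube. b j * monom_at (- j)))
    = (\<Sum>j\<in>cube. a j * b j)"
proof -
  let ?A = "\<Sum>j\<in>cube. a j * monom_at j"
  have A: "?A \<in> Ll1"
    by (rule Ll1_sum) (rule Ll1_mult[OF subsetD[OF Ll1_down_subset_Ll1 a] Ll1_monom])
  have "rho (?A * (\<Sum>j\<in>cube. b j * monom_at (- j)))
      = rho (\<Sum>j\<in>cube. b j * (?A * monom_at (- j)))"
    unfolding sum_distrib_left[of ?A] by (simp only: mult.left_commute)
  also have "\<dots> = (\<Sum>j\<in>cube. rho (b j * (?A * monom_at (- j))))"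
    by (rule rho_sum) (rule Ll1_mult[OF subsetD[OF Ll1_down_subset_Ll1 b] Ll1_mult[OF A Ll1_monom]])
  also have "\<dots> = (\<Sum>j\<in>cube. a j * b j)"
  proof (rule sum.cong)
    fix j :: "int ^ 'n" assume j: "j \<in> cube"
    have "rho (b j * (?A * monom_at (- j))) = b j * rho (?A * monom_at (- j))"
      by (rule rho_mult_down) (use A b j in \<open>simp_all add: Ll1_mult Ll1_monom\<close>)
    moreover have "rho (?A * monom_at (- j)) = a j"
      using a j by (rule rho_monom_dual)
    ultimately show "rho (b j * (?A * monom_at (- j))) = a j * b j"
      by (simp only: mult.commute)
  qed simp
  finally show ?thesis .
qed

text \<open>Conjugation exchanges z^j and z^-j, so the expansion of \<open>lconj G\<close> in the
  z^j yields that of \<open>G\<close> in the z^-j.\<close>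

lemma neg_components_exist:
  assumes "G \<in> Ll1"
  obtains g where "\<And>j. j \<in> cube \<Longrightarrow> g j \<in> Ll1_down" "G = (\<Sum>j\<in>cube. g j * monom_at (- j))"
proof -
  obtain b where b: "\<And>j. j \<in> cube \<Longrightarrow> b j \<in> Ll1_down" "lconj G = (\<Sum>j\<in>cube. b j * monom_at j)"
    using components_exist[OF Ll1_lconj[OF assms]] by blast
  have b1: "b j \<in> Ll1" if "j \<in> cube" for j
    using b(1)[OF that] Ll1_down_subset_Ll1 by blast
  have "G = lconj (\<Sum>j\<in>cube. b j * monom_at j)"
    using b(2) lconj_lconj[OF assms] by simp
  also have "\<dots> = (\<Sum>j\<in>cube. lconj (b j) * monom_at (- j))"
    using b1 by (simp add: lconj_sum Ll1_mult Ll1_monom lconj_mult lconj_monom)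
  finally show ?thesis
    using that[of "\<lambda>j. lconj (b j)"] b(1) Ll1_down_lconj by blast
qed

text \<open>Conjugating the relation reduces independence of the z^-j to
  \<open>components_unique\<close> for the z^j.\<close>

lemma neg_components_zero:
  assumes g: "\<And>j. j \<in> cube \<Longrightarrow> g j \<in> Ll1_down"
    and 0: "(\<Sum>j\<in>cube. g j * monom_at (- j)) = 0" and m: "m \<in> cube"
  shows "g m = 0"
proof -
  have g1: "g j \<in> Ll1" if "j \<in> cube" for j
    using g[OF that] Ll1_down_subset_Ll1 by blast
  have "(\<Sum>j\<in>cube. lconj (g j) * monom_at j) = lconj (\<Sum>j\<in>cube. g j * monom_at (- j))"
    using g1 by (simp add: lconj_sum Ll1_mult Ll1_monom lconj_mult lconj_monom)
  then have "lconj (g m) = 0"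
    using components_unique[of "\<lambda>j. lconj (g j)" "\<lambda>_. 0" m] 0 g m
    by (simp add: lconj_0 Ll1_down_lconj Ll1_down_0)
  then show ?thesis
    using lconj_lconj[OF g1[OF m]] by (simp add: lconj_0)
qed

lemma rhoU_add:
  "U \<in> Ll1 \<Longrightarrow> F \<in> Ll1 \<Longrightarrow> G \<in> Ll1 \<Longrightarrow> rhoU U (F + G) = rhoU U F + rhoU U G"
  by (simp add: rhoU_def lconj_add distrib_left rho_add Ll1_mult Ll1_lconj)

text \<open>The argument of \<open>rhoU\<close> enters conjugated, so the map is only semilinear;
  hence the conjugated scalars in the main proof.\<close>

lemma rhoU_mult_down:
  assumes "U \<in> Ll1" "c \<in> Ll1_down" "F \<in> Ll1"
  shows "rhoU U (c * F) = lconj c * rhoU U F"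
proof -
  have "c \<in> Ll1"
    using assms Ll1_down_subset_Ll1 by blast
  then have "U * lconj (c * F) = lconj c * (U * lconj F)"
    using assms by (simp add: lconj_mult mult_ac)
  then show ?thesis
    using assms by (simp add: rhoU_def rho_mult_down Ll1_down_lconj Ll1_mult Ll1_lconj)
qed


section \<open>The kernel basis and its extension to the whole ring\<close>

theorem proposition4p4:
  fixes U V :: "'n::finite torus_fun"
    and d D Hs :: "int ^ 'n \<Rightarrow> 'n torus_fun"
  assumes U: "U \<in> Lpoly"
    and V: "V \<in> Lpoly" "invertible_in Ll1 V"
    and d: "\<forall>j\<in>cube. d j \<in> Lpoly_down" "U * V = (\<Sum>j\<in>cube. d j * monom_at j)"
    and d0: "d 0 \<noteq> 0" "invertible_in Ll1_down (d 0)"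
    and D: "\<forall>j\<in>cube - {0}. D j = d j - d 0 * monom_at (- j)"
    and Hs: "\<forall>j\<in>cube - {0}. Hs j = lconj V * lconj (D j)"
  shows "(\<forall>j\<in>cube - {0}. rho (U * V * D j) = 0) \<and>
    is_basis_over Ll1_down (Ker_rhoU U) (cube - {0}) Hs \<and>
    (\<forall>H\<in>Lpoly. invertible_in Ll1_down (rhoU U H) \<longrightarrow>
           (\<forall>j\<in>cube - {0}. Hs j \<in> Lpoly) \<and>
           is_basis_over Ll1_down Ll1 cube (Hs(0 := H)))"
proof -
  have UL: "U \<in> Ll1" and VL: "V \<in> Ll1"
    using U V Lpoly_subset_Ll1 by blast+
  obtain W where W: "W \<in> Ll1" "V * W = 1"
    using V by (auto simp: invertible_in_def)
  obtain e where e: "e \<in> Ll1_down" "d 0 * e = 1"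
    using d0 by (auto simp: invertible_in_def)
  have dd: "d j \<in> Ll1_down" if "j \<in> cube" for j
    using d that Lpoly_down_subset_Ll1_down by blast
  have down: "c \<in> Ll1" if "c \<in> Ll1_down" for c :: "'n torus_fun"
    using that Ll1_down_subset_Ll1 by blast
  have D_Lpoly: "D j \<in> Lpoly" if "j \<in> cube - {0}" for j
    using D d that Lpoly_down_subset_Lpoly
    by (auto intro!: Lpoly_diff Lpoly_mult Lpoly_monom simp: subset_iff)
  have DL: "D j \<in> Ll1" if "j \<in> cube - {0}" for j
    using D_Lpoly[OF that] Lpoly_subset_Ll1 by blast
  have Hs_Lpoly: "Hs j \<in> Lpoly" if "j \<in> cube - {0}" for j
    using Hs that V D_Lpoly[OF that] by (simp add: Lpoly_mult Lpoly_lconj)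
  have HsL: "Hs j \<in> Ll1" if "j \<in> cube - {0}" for j
    using Hs_Lpoly[OF that] Lpoly_subset_Ll1 by blast
  have lconj_Hs: "lconj (Hs j) = V * D j" if "j \<in> cube - {0}" for j
    using Hs that VL DL[OF that] by (simp add: lconj_mult Ll1_lconj lconj_lconj)
  have split: "(\<Sum>j\<in>cube. f j) = f 0 + (\<Sum>j\<in>cube - {0}. f j)" for f :: "int ^ 'n \<Rightarrow> 'n torus_fun"
    by (rule sum.remove) auto

  define comb where "comb c = (\<Sum>j\<in>cube - {0}. c j * D j)" for c
  \<comment> \<open>Each \<open>D j\<close> contributes \<open>d j\<close> at exponent 0 and
    \<open>- d 0\<close> at exponent -j, which gives the coordinates of \<open>comb c\<close> in the
    dual basis.\<close>
  have comb: "comb c = (\<Sum>j\<in>cube. (if j = 0 then \<Sum>i\<in>cube - {0}. c i * d i else - (c j * d 0))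
      * monom_at (- j))" for c
  proof -
    have "comb c = (\<Sum>j\<in>cube - {0}. c j * d j) + (\<Sum>j\<in>cube - {0}. - (c j * d 0) * monom_at (- j))"
      unfolding comb_def sum.distrib[symmetric]
    proof (rule sum.cong)
      fix j :: "int ^ 'n" assume "j \<in> cube - {0}"
      then have Dj: "D j = d j - d 0 * monom_at (- j)"
        using D by blast
      show "c j * D j = c j * d j + - (c j * d 0) * monom_at (- j)"
        unfolding Dj by (simp add: algebra_simps)
    qed simp
    moreover have "(\<Sum>j\<in>cube - {0}. - (c j * d 0) * monom_at (- j)) = (\<Sum>j\<in>cube - {0}.
        (if j = 0 then \<Sum>i\<in>cube - {0}. c i * d i else - (c j * d 0)) * monom_at (- j))"
      by (intro sum.cong) auto
    ultimately show ?thesis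
      by (simp add: split)
  qed

  \<comment> \<open>In the pairing with \<open>U * V\<close>, the term at 0 is \<open>d 0\<close>
    times the sum of the \<open>c j * d j\<close>, and the remaining terms cancel it.\<close>
  have rho_comb: "rho (U * V * comb c) = 0" if "\<And>j. j \<in> cube - {0} \<Longrightarrow> c j \<in> Ll1_down" for c
  proof -
    have "rho (U * V * comb c)
        = (\<Sum>j\<in>cube. d j * (if j = 0 then \<Sum>i\<in>cube - {0}. c i * d i else - (c j * d 0)))"
      unfolding comb d(2)
      by (rule rho_pairing)
         (auto simp: dd that intro!: Ll1_down_sum Ll1_down_mult Ll1_down_uminus)
    also have "\<dots> = d 0 * (\<Sum>j\<in>cube - {0}. c j * d j) + (\<Sum>j\<in>cube - {0}. - (d 0 * (c j * d j)))"
      unfolding split by (intro arg_cong2[where f = "(+)"] sum.cong) (auto simp: mult_ac)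
    finally show ?thesis
      by (simp add: sum_negf sum_distrib_left)
  qed

  have comb_surj: "\<exists>c. (\<forall>j\<in>cube - {0}. c j \<in> Ll1_down) \<and> G = comb c"
    if G: "G \<in> Ll1" "rho (U * V * G) = 0" for G
  proof -
    obtain g where g: "\<And>j. j \<in> cube \<Longrightarrow> g j \<in> Ll1_down" "G = (\<Sum>j\<in>cube. g j * monom_at (- j))"
      using neg_components_exist[OF G(1)] by blast
    have "(\<Sum>j\<in>cube. d j * g j) = 0"
      using G(2) rho_pairing[of d g] dd g(1) by (simp add: d(2) g(2))
    \<comment> \<open>Since \<open>d 0\<close> is a unit, this equation determines
      \<open>g 0\<close> from the other coordinates.\<close>
    then have "d 0 * g 0 = - (\<Sum>j\<in>cube - {0}. d j * g j)"
      by (simp add: split add_eq_0_iff2)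
    moreover have ed: "e * (d 0 * x) = x" for x
      using e(2) by (metis mult.assoc mult.commute mult_1)
    ultimately have "g 0 = e * - (\<Sum>j\<in>cube - {0}. d j * g j)"
      by metis
    then have g0: "g 0 = (\<Sum>j\<in>cube - {0}. - (e * g j) * d j)"
      by (simp add: sum_negf sum_distrib_left mult_ac)
    \<comment> \<open>Solves \<open>- (c j * d 0) = g j\<close>, matching the coordinates away from
      0; \<open>g0\<close> then matches the one at 0.\<close>
    define c where "c j = - (e * g j)" for j
    have "G = comb c"
      unfolding g(2) comb
    proof (rule sum.cong)
      fix j
      have "- (c j * d 0) = g j"
        using ed[of "g j"] by (simp add: c_def mult_ac)
      then show "g j * monom_at (- j)
        = (if j = 0 then \<Sum>i\<in>cube - {0}. c i * d i else - (c j * d 0)) * monom_at (- j)"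
        using g0 by (simp add: c_def)
    qed simp
    moreover have "\<forall>j\<in>cube - {0}. c j \<in> Ll1_down"
      using e g by (auto simp: c_def intro: Ll1_down_uminus Ll1_down_mult)
    ultimately show ?thesis
      by blast
  qed

  have comb_inj: "c m = 0"
    if c: "\<And>j. j \<in> cube - {0} \<Longrightarrow> c j \<in> Ll1_down" and "comb c = 0" and m: "m \<in> cube - {0}" for c m
  proof -
    have "(if m = 0 then \<Sum>i\<in>cube - {0}. c i * d i else - (c m * d 0)) = 0"
    proof (rule neg_components_zero[of "\<lambda>j. if j = 0 then \<Sum>i\<in>cube - {0}. c i * d i else - (c j * d 0)"])
      show "(\<Sum>j\<in>cube. (if j = 0 then \<Sum>i\<in>cube - {0}. c i * d i else - (c j * d 0))
          * monom_at (- j)) = 0"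
        using comb[of c] \<open>comb c = 0\<close> by simp
    qed (use c dd m in \<open>auto intro!: Ll1_down_sum Ll1_down_mult Ll1_down_uminus\<close>)
    \<comment> \<open>The coordinate at -m is \<open>- (c m * d 0)\<close>, and \<open>e\<close>
      inverts \<open>d 0\<close>.\<close>
    then have "c m * d 0 * e = 0"
      using m by simp
    then show ?thesis
      using e(2) by (simp add: mult.assoc)
  qed

  \<comment> \<open>The bridge between combinations of the \<open>Hs j\<close> and solutions of the
    pairing equation.\<close>
  have lconj_comb: "lconj (\<Sum>j\<in>cube - {0}. c j * Hs j) = V * comb (\<lambda>j. lconj (c j))"
    if "\<And>j. j \<in> cube - {0} \<Longrightarrow> c j \<in> Ll1_down" for c
    using that HsL down
    by (simp add: lconj_sum Ll1_mult lconj_mult lconj_Hs comb_def sum_distrib_left mult_ac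
             del: Diff_iff)

  have rho_D: "rho (U * V * D j) = 0" if "j \<in> cube - {0}" for j
  proof -
    have "comb (\<lambda>i. if i = j then 1 else 0) = D j"
      unfolding comb_def using that by (simp add: if_distrib[of "\<lambda>x. x * _"] cong: if_cong)
    \<comment> \<open>Obtained as the product of \<open>d 0\<close> and its inverse
      \<open>e\<close>.\<close>
    moreover have "(1 :: 'n torus_fun) \<in> Ll1_down"
      using Ll1_down_mult[OF dd[OF zero_in_cube] e(1)] e(2) by simp
    ultimately show ?thesis
      using rho_comb[of "\<lambda>i. if i = j then 1 else 0"] by (simp add: Ll1_down_0)
  qed

  have Hs_inj: "c m = 0"
    if c: "\<And>j. j \<in> cube - {0} \<Longrightarrow> c j \<in> Ll1_down" and 0: "(\<Sum>j\<in>cube - {0}. c j * Hs j) = 0"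
      and m: "m \<in> cube - {0}" for c m
  proof -
    have "V * comb (\<lambda>j. lconj (c j)) = 0"
      using lconj_comb[of c] c 0 by (simp add: lconj_0)
    \<comment> \<open>Multiplying by \<open>W\<close> cancels \<open>V\<close>, so independence of
      the \<open>D j\<close> applies.\<close>
    then have "V * W * comb (\<lambda>j. lconj (c j)) = 0"
      by (metis mult.assoc mult.commute mult_zero_right)
    then have "lconj (c m) = 0"
      using comb_inj[of "\<lambda>j. lconj (c j)" m] c m by (simp add: W Ll1_down_lconj)
    then have "lconj (lconj (c m)) = 0"
      by (simp add: lconj_0)
    then show ?thesis
      using lconj_lconj[OF down[OF c[OF m]]] by simp
  qed

  have Hs_in_Ker: "(\<Sum>j\<in>cube - {0}. c j * Hs j) \<in> Ker_rhoU U"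
    if c: "\<And>j. j \<in> cube - {0} \<Longrightarrow> c j \<in> Ll1_down" for c
  proof -
    have "rho (U * V * comb (\<lambda>j. lconj (c j))) = 0"
      by (rule rho_comb, rule Ll1_down_lconj, rule c)
    moreover have "lconj (\<Sum>j\<in>cube - {0}. c j * Hs j) = V * comb (\<lambda>j. lconj (c j))"
      using c by (rule lconj_comb)
    ultimately have "rhoU U (\<Sum>j\<in>cube - {0}. c j * Hs j) = 0"
      by (simp add: rhoU_def mult.assoc)
    then show ?thesis
      unfolding Ker_rhoU_def using c down HsL by (auto intro!: Ll1_sum Ll1_mult)
  qed

  have Ker_in_Hs: "\<exists>c. (\<forall>j\<in>cube - {0}. c j \<in> Ll1_down) \<and> F = (\<Sum>j\<in>cube - {0}. c j * Hs j)"
    if "F \<in> Ker_rhoU U" for F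
  proof -
    have F: "F \<in> Ll1" "rho (U * lconj F) = 0"
      using that by (auto simp: Ker_rhoU_def rhoU_def)
    \<comment> \<open>Dividing \<open>lconj F\<close> by \<open>V\<close> turns the kernel condition
      into the equation solved by \<open>comb_surj\<close>.\<close>
    have VWF: "V * (W * lconj F) = lconj F"
      using W(2) by (simp flip: mult.assoc)
    then have "rho (U * V * (W * lconj F)) = 0"
      using F(2) by (simp add: mult.assoc)
    then obtain c where c: "\<And>j. j \<in> cube - {0} \<Longrightarrow> c j \<in> Ll1_down" "W * lconj F = comb c"
      using comb_surj[of "W * lconj F"] F W by (auto simp: Ll1_mult Ll1_lconj)
    define c' where "c' j = lconj (c j)" for j
    have c': "c' j \<in> Ll1_down" "lconj (c' j) = c j" if "j \<in> cube - {0}" for j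
      using c(1)[OF that] down by (auto simp: c'_def Ll1_down_lconj lconj_lconj)
    have "comb (\<lambda>j. lconj (c' j)) = comb c"
      unfolding comb_def by (intro sum.cong) (simp_all add: c'(2) del: Diff_iff)
    moreover have "lconj (\<Sum>j\<in>cube - {0}. c' j * Hs j) = V * comb (\<lambda>j. lconj (c' j))"
      using c'(1) by (rule lconj_comb)
    \<comment> \<open>Both arguments lie in \<open>Ll1\<close>, where conjugation is an involution,
      so they coincide.\<close>
    ultimately have "lconj (lconj (\<Sum>j\<in>cube - {0}. c' j * Hs j)) = lconj (lconj F)"
      using c(2) VWF by simp
    moreover have "(\<Sum>j\<in>cube - {0}. c' j * Hs j) \<in> Ll1"
      using c'(1) down HsL by (intro Ll1_sum Ll1_mult) auto
    ultimately show ?thesis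
      using c'(1) F(1) by (metis lconj_lconj)
  qed

  have basis_Ker: "is_basis_over Ll1_down (Ker_rhoU U) (cube - {0}) Hs"
    unfolding is_basis_over_def
  proof (intro conjI allI impI ballI equalityI subsetI)
    fix F assume "F \<in> {\<Sum>i\<in>cube - {0}. c i * Hs i |c. \<forall>i\<in>cube - {0}. c i \<in> Ll1_down}"
    then show "F \<in> Ker_rhoU U"
      using Hs_in_Ker by blast
  qed (simp, use Ker_in_Hs in blast, use Hs_inj in blast)

  have basis_Ll1: "is_basis_over Ll1_down Ll1 cube (Hs(0 := H))"
    if HL: "H \<in> Lpoly" and inv: "invertible_in Ll1_down (rhoU U H)" for H
  proof -
    have H: "H \<in> Ll1"
      using HL Lpoly_subset_Ll1 by blast
    obtain r where r: "r \<in> Ll1_down" "rhoU U H * r = 1"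
      using inv by (auto simp: invertible_in_def)
    have rhoH: "rhoU U F \<in> Ll1_down" if "F \<in> Ll1" for F
      using that UL by (simp add: rhoU_def rho_Ll1 Ll1_mult Ll1_lconj)
    \<comment> \<open>The kernel basis leaves index 0 free, and \<open>H\<close> takes that
      place.\<close>
    have upd: "(\<Sum>j\<in>cube. c j * (Hs(0 := H)) j) = c 0 * H + (\<Sum>j\<in>cube - {0}. c j * Hs j)" for c
      unfolding split by (intro arg_cong2[where f = "(+)"] sum.cong) auto
    show ?thesis
      unfolding is_basis_over_def upd
    proof (intro conjI allI impI equalityI subsetI finite_cube)
      fix F :: "'n torus_fun" assume F: "F \<in> Ll1"
      \<comment> \<open>Chosen so that \<open>lconj q * rhoU U H = rhoU U F\<close>; by
        semilinearity \<open>F - q * H\<close> then lies in the kernel.\<close>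
      define q where "q = lconj (rhoU U F * r)"
      have q: "q \<in> Ll1_down" "lconj q = rhoU U F * r"
        using F r(1) rhoH down
        by (auto simp: q_def Ll1_down_lconj Ll1_down_mult lconj_lconj)
      have "F - q * H \<in> Ll1"
        using F H q(1) down by (simp add: Ll1_diff Ll1_mult)
      moreover have "rhoU U (F - q * H) = 0"
      proof -
        have "rhoU U F = rhoU U (F - q * H) + rhoU U (q * H)"
          using rhoU_add[OF UL, of "F - q * H" "q * H"] H q(1) down \<open>F - q * H \<in> Ll1\<close>
          by (simp add: Ll1_mult)
        moreover have "rhoU U (q * H) = rhoU U F * (rhoU U H * r)"
          using rhoU_mult_down[OF UL q(1) H] q(2) by (simp add: mult_ac)
        ultimately show ?thesis
          using r(2) by simp
      qed
      ultimately obtain c where c: "\<forall>j\<in>cube - {0}. c j \<in> Ll1_down"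
          "F - q * H = (\<Sum>j\<in>cube - {0}. c j * Hs j)"
        using Ker_in_Hs[of "F - q * H"] by (auto simp: Ker_rhoU_def)
      have "(\<Sum>j\<in>cube - {0}. (c(0 := q)) j * Hs j) = F - q * H"
        unfolding c(2) by (intro sum.cong) auto
      then show "F \<in> {c 0 * H + (\<Sum>j\<in>cube - {0}. c j * Hs j) |c. \<forall>i\<in>cube. c i \<in> Ll1_down}"
        using c(1) q(1) by (intro CollectI exI[of _ "c(0 := q)"]) simp
    next
      fix F assume "F \<in> {c 0 * H + (\<Sum>j\<in>cube - {0}. c j * Hs j) |c. \<forall>i\<in>cube. c i \<in> Ll1_down}"
      then show "F \<in> Ll1"
        using H HsL down by (auto intro!: Ll1_add Ll1_sum Ll1_mult)
    next
      fix c assume "(\<forall>i\<in>cube. c i \<in> Ll1_down) \<and> c 0 * H + (\<Sum>j\<in>cube - {0}. c j * Hs j) = 0"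
      then have c: "\<And>j. j \<in> cube \<Longrightarrow> c j \<in> Ll1_down"
        and sum0: "c 0 * H + (\<Sum>j\<in>cube - {0}. c j * Hs j) = 0"
        by auto
      let ?K = "\<Sum>j\<in>cube - {0}. c j * Hs j"
      have K: "?K \<in> Ll1" "rhoU U ?K = 0"
        using Hs_in_Ker[of c] c by (auto simp: Ker_rhoU_def)
      have c0: "c 0 \<in> Ll1_down"
        using c by simp
      \<comment> \<open>Applying \<open>rhoU U\<close> to the relation removes the kernel part; the
        unit \<open>rhoU U H\<close> then forces \<open>c 0 = 0\<close>, and independence of the
        \<open>Hs j\<close> handles the rest.\<close>
      have "rhoU U (c 0 * H + ?K) = lconj (c 0) * rhoU U H"
        using rhoU_add[OF UL Ll1_mult[OF down[OF c0] H] K(1)] K(2) rhoU_mult_down[OF UL c0 H]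
        by simp
      moreover have "rhoU U 0 = 0"
        by (simp add: rhoU_def lconj_0 rho_0)
      ultimately have "lconj (c 0) * rhoU U H * r = 0"
        using sum0 by simp
      then have "lconj (c 0) = 0"
        using r(2) by (simp add: mult.assoc)
      then have "c 0 = 0"
        using lconj_lconj[OF down[OF c0]] by (simp add: lconj_0)
      moreover have "c m = 0" if "m \<in> cube - {0}" for m
        using Hs_inj[of c m] c sum0 \<open>c 0 = 0\<close> that by simp
      ultimately show "\<forall>i\<in>cube. c i = 0"
        by blast
    qed
  qed
  show ?thesis
    by (intro conjI ballI impI) (rule rho_D basis_Ker Hs_Lpoly basis_Ll1; assumption)+
qed

end
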